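(* Let $f,g,h$ be functions on $\mathbb{R}^n$, with $F=f+g+h$, satisfying the assumptions in the context, and let $(\beta_k)_{k\ge 1}$ be a sequence of positive reals. Let $(x_k)_{k\ge1},(y_k)_{k\ge1},(\theta_k)_{k\ge1},(L_k)_{k\ge1}$ be the sequences generated by the PRISMA algorithm (defined in the context) with parameters $(\beta_k)$. If the sequence $(\beta_k)$ is nonincreasing, then for every $k\ge 1$ and every $x^*\in\operatorname{dom} h$, $$F(x_{k+1})-F(x^* )\le \frac12\,\theta_k^2 L_k\left(\|x^*-x_1\|^2+\rho_g^2\sum_{i=1}^k\frac{\beta_i}{\theta_i L_i}\right).$$
   Context: Norms and inner products are Euclidean. Assumptions: (i) $f:\mathbb{R}^n\to\mathbb{R}$ is convex and $L_f$-smooth, i.e. differentiable with $\|\nabla f(x)-\nabla f(y)\|\le L_f\|x-y\|$ for all $x,y\in\mathbb{R}^n$; (ii) $g:\mathbb{R}^n\to\mathbb{R}$ is convex and $\rho_g$-Lipschitz, i.e. $|g(x)-g(y)|\le\rho_g\|x-y\|$ for all $x,y$; (iii) $h:\mathbb{R}^n\to\mathbb{R}\cup\{+\infty\}$ is proper, lower semicontinuous and convex, with $\operatorname{dom}h=\{x:h(x)<+\infty\}$. Put $F(x)=f(x)+g(x)+h(x)$. Proximity operator: for a proper lower semicontinuous convex function $\varphi$, $x\in\mathbb{R}^n$ and $\alpha>0$, $\operatorname{prox}_\varphi(x,\alpha)=\operatorname{argmin}_{u\in\mathbb{R}^n}\left\{\frac{\|x-u\|^2}{2\alpha}+\varphi(u)\right\}$.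 PRISMA algorithm with parameters $\beta_k>0$, $k\in\{1,2,\dots\}$: choose $x_1=y_1\in\operatorname{dom}h$, set $\theta_1=1$, $L_1=L_f+\frac1{\beta_1}$, and for $k=1,2,\dots$ set $$L_{k+1}=L_f+\frac1{\beta_{k+1}},\qquad \theta_{k+1}=\frac{2}{1+\sqrt{1+\frac{4L_{k+1}}{\theta_k^2L_k}}},$$ $$x_{k+1}=\operatorname{prox}_h\left(\Big(1-\tfrac1{L_k\beta_k}\Big)y_k-\tfrac1{L_k}\nabla f(y_k)+\tfrac1{L_k\beta_k}\operatorname{prox}_g(y_k,\beta_k),\ \tfrac1{L_k}\right),$$ $$y_{k+1}=x_{k+1}+\theta_{k+1}\left(\tfrac1{\theta_k}-1\right)(x_{k+1}-x_k).$$ *)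

theory Defs
  imports "HOL-Analysis.Analysis"
begin

definition gradient :: "('a::real_inner \<Rightarrow> real) \<Rightarrow> 'a \<Rightarrow> 'a" where
  "gradient f x = (THE D. GDERIV f x :> D)"

definition L_smooth :: "real \<Rightarrow> ('a::real_inner \<Rightarrow> real) \<Rightarrow> bool" where
  "L_smooth L f \<longleftrightarrow>
     (\<forall>x. f differentiable (at x)) \<and>
     (\<forall>x y. norm (gradient f x - gradient f y) \<le> L * norm (x - y))"

text \<open>
  Functions with values in the reals extended by plus infinity are represented as
  \<^typ>\<open>ereal\<close>-valued functions; the value minus infinity is excluded by \<open>proper\<close>.
\<close>

definition eff_dom :: "('a \<Rightarrow> ereal) \<Rightarrow> 'a set" where
  "eff_dom h = {x. h x < \<infinity>}"

definition proper :: "('a \<Rightarrow> ereal) \<Rightarrow> bool" where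
  "proper h \<longleftrightarrow> (\<forall>x. h x \<noteq> -\<infinity>) \<and> eff_dom h \<noteq> {}"

definition lower_semicontinuous :: "('a::topological_space \<Rightarrow> ereal) \<Rightarrow> bool" where
  "lower_semicontinuous h \<longleftrightarrow> (\<forall>x. h x \<le> Liminf (at x) h)"

text \<open>
  At the end points of the segment the inequality relies on the convention
  \<open>0 * \<infinity> = 0\<close> of \<^typ>\<open>ereal\<close>, under which it is trivially true.
\<close>

definition convex_ereal :: "('a::real_vector \<Rightarrow> ereal) \<Rightarrow> bool" where
  "convex_ereal h \<longleftrightarrow>
     (\<forall>x y. \<forall>u\<ge>0. \<forall>v\<ge>0. u + v = 1 \<longrightarrow>
        h (u *\<^sub>R x + v *\<^sub>R y) \<le> ereal u * h x + ereal v * h y)"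

text \<open>
  The minimiser is unique when \<open>\<phi>\<close> is proper, lower semicontinuous and convex on a
  Euclidean space and \<open>\<alpha> > 0\<close>, so the choice made by \<^const>\<open>arg_min\<close> is immaterial there.
\<close>

definition prox :: "('a::real_inner \<Rightarrow> ereal) \<Rightarrow> 'a \<Rightarrow> real \<Rightarrow> 'a" where
  "prox \<phi> x \<alpha> = arg_min (\<lambda>u. ereal ((norm (x - u))\<^sup>2 / (2 * \<alpha>)) + \<phi> u) (\<lambda>u. True)"

text \<open>All sequences are indexed from 1; their values at index 0 are unconstrained.\<close>

definition prisma ::
  "('a::real_inner \<Rightarrow> real) \<Rightarrow> ('a \<Rightarrow> real) \<Rightarrow> ('a \<Rightarrow> ereal) \<Rightarrow> real \<Rightarrow> (nat \<Rightarrow> real) \<Rightarrow>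
   (nat \<Rightarrow> 'a) \<Rightarrow> (nat \<Rightarrow> 'a) \<Rightarrow> (nat \<Rightarrow> real) \<Rightarrow> (nat \<Rightarrow> real) \<Rightarrow> bool" where
  "prisma f g h Lf \<beta> x y \<theta> L \<longleftrightarrow>
     x 1 = y 1 \<and> x 1 \<in> eff_dom h \<and> \<theta> 1 = 1 \<and> L 1 = Lf + 1 / \<beta> 1 \<and>
     (\<forall>k\<ge>1.
        L (k + 1) = Lf + 1 / \<beta> (k + 1) \<and>
        \<theta> (k + 1) = 2 / (1 + sqrt (1 + 4 * L (k + 1) / ((\<theta> k)\<^sup>2 * L k))) \<and>
        x (k + 1) =
          prox h
            ((1 - 1 / (L k * \<beta> k)) *\<^sub>R y k
              - (1 / L k) *\<^sub>R gradient f (y k)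
              + (1 / (L k * \<beta> k)) *\<^sub>R prox (\<lambda>u. ereal (g u)) (y k) (\<beta> k))
            (1 / L k) \<and>
        y (k + 1) = x (k + 1) + (\<theta> (k + 1) * (1 / \<theta> k - 1)) *\<^sub>R (x (k + 1) - x k))"

end

theory Submission
  imports Defs
begin

text \<open>
  Let \<open>M\<^sub>k\<close> be the Moreau envelope of \<open>g\<close> with parameter \<open>\<beta>\<^sub>k\<close>. PRISMA is accelerated
  forward-backward splitting for \<open>F\<^sub>k = f + M\<^sub>k + h\<close>, whose smooth part has modulus \<open>L\<^sub>k\<close>, with
  the smoothing changing along the way. Lipschitz continuity gives \<open>F \<le> F\<^sub>k + \<rho>\<^sup>2 \<beta>\<^sub>k / 2\<close>, and
  the corrected functions \<open>F\<^sub>k + \<rho>\<^sup>2 \<beta>\<^sub>k / 2\<close> decrease pointwise with \<open>k\<close>, so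
  \<open>A\<^sub>k = F\<^sub>k(x\<^sub>k\<^sub>+\<^sub>1) + \<rho>\<^sup>2 \<beta>\<^sub>k / 2 - F(s)\<close> satisfies
  \<open>A\<^sub>k \<le> (1 - \<theta>\<^sub>k) A\<^sub>k\<^sub>-\<^sub>1 + \<theta>\<^sub>k \<rho>\<^sup>2 \<beta>\<^sub>k / 2 + \<theta>\<^sub>k\<^sup>2 L\<^sub>k / 2 (|s - v\<^sub>k|\<^sup>2 - |s - v\<^sub>k\<^sub>+\<^sub>1|\<^sup>2)\<close>
  for auxiliary points \<open>v\<^sub>k\<close>. The choice of \<open>\<theta>\<^sub>k\<close> makes this telescope after division by
  \<open>\<theta>\<^sub>k\<^sup>2 L\<^sub>k\<close>; keeping the correction inside \<open>A\<^sub>k\<close> is what leaves only \<open>\<beta>\<^sub>i / (\<theta>\<^sub>i L\<^sub>i)\<close> in the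
  sum rather than \<open>\<beta>\<^sub>i / (\<theta>\<^sub>i\<^sup>2 L\<^sub>i)\<close>.
\<close>

section \<open>Existence of the proximal point\<close>

text \<open>Without a minimizer, each \<open>u\<close> has a neighbourhood on which \<open>h\<close>
  exceeds some \<open>h (v u)\<close>. Among the finitely many such values from a subcover, the
  smallest is taken at a point that lies in one of the neighbourhoods and so exceeds another
  value.\<close>

lemma lower_semicontinuous_attains_inf:
  fixes h :: "'a::topological_space \<Rightarrow> ereal"
  assumes lsc: "lower_semicontinuous h" and S: "compact S" "S \<noteq> {}"
  shows "\<exists>u\<in>S. \<forall>v\<in>S. h u \<le> h v"
proof (rule ccontr)
  assume "\<not> ?thesis"
  then have less: "\<exists>v\<in>S. h v < h u" if "u \<in> S" for u
    using that by (meson not_le)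
  have "\<exists>v U. v \<in> S \<and> open U \<and> u \<in> U \<and> (\<forall>w\<in>U. h v < h w)" if u: "u \<in> S" for u
  proof -
    obtain v where v: "v \<in> S" "h v < h u"
      using less[OF u] by blast
    have "h u \<le> Liminf (at u) h"
      using lsc by (simp add: lower_semicontinuous_def)
    then have "eventually (\<lambda>w. h v < h w) (at u)"
      using v(2) by (simp add: le_Liminf_iff)
    then obtain U where "open U" "u \<in> U" "\<forall>w\<in>U. w \<noteq> u \<longrightarrow> h v < h w"
      by (auto simp: eventually_at_topological)
    \<comment> \<open>\<open>Liminf (at u) h\<close> ignores \<open>u\<close> itself, where the
      bound is \<open>h v < h u\<close>.\<close>
    with v show ?thesis by metis
  qed
  then obtain v U where vU: "\<And>u. u \<in> S \<Longrightarrow> v u \<in> S" "\<And>u. u \<in> S \<Longrightarrow> open (U u)"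
    "\<And>u. u \<in> S \<Longrightarrow> u \<in> U u" "\<And>u w. u \<in> S \<Longrightarrow> w \<in> U u \<Longrightarrow> h (v u) < h w"
    by metis
  have "S \<subseteq> (\<Union>u\<in>S. U u)" using vU(3) by blast
  then obtain C where C: "C \<subseteq> S" "finite C" "S \<subseteq> (\<Union>u\<in>C. U u)"
    using compactE_image[OF S(1), of S U] vU(2) by metis
  have "C \<noteq> {}" using C(3) S(2) by auto
  then obtain c where c: "c \<in> C" "\<And>d. d \<in> C \<Longrightarrow> h (v c) \<le> h (v d)"
    using ex_is_arg_min_if_finite[OF C(2), of "\<lambda>u. h (v u)"] by (auto simp: is_arg_min_linorder)
  then obtain d where "d \<in> C" "v c \<in> U d"
    using C(1,3) vU(1) by blast
  then show False
    using c(2)[of d] vU(4)[of d "v c"] C(1) by force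
qed

text \<open>
  Convexity along rays from \<open>x0\<close> propagates the minimum over the unit ball to a lower bound
  that decreases at most linearly, which makes the proximal objective coercive without
  recourse to a supporting hyperplane.
\<close>

lemma proper_lsc_convex_linear_lower_bound:
  fixes h :: "'a::euclidean_space \<Rightarrow> ereal"
  assumes "proper h" and lsc: "lower_semicontinuous h" and conv: "convex_ereal h"
    and x0: "h x0 = ereal H"
  shows "\<exists>K\<ge>0. \<forall>u. ereal (H - K * (1 + norm (u - x0))) \<le> h u"
proof -
  obtain p where p: "p \<in> cball x0 1" "\<And>v. v \<in> cball x0 1 \<Longrightarrow> h p \<le> h v"
    using lower_semicontinuous_attains_inf[OF lsc, of "cball x0 1"] by auto
  have "h p \<le> h x0" by (rule p(2)) simp
  moreover have "h p \<noteq> -\<infinity>" using assms(1) by (simp add: proper_def)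
  ultimately obtain m where m: "h p = ereal m" "m \<le> H"
    using x0 by (cases "h p") auto
  have "ereal (H - (H - m) * (1 + norm (u - x0))) \<le> h u" for u
  proof (cases "norm (u - x0) \<le> 1")
    case True
    then have "ereal m \<le> h u"
      using p(2)[of u] m by (simp add: dist_norm norm_minus_commute)
    moreover have "H - (H - m) * (1 + norm (u - x0)) \<le> m"
      using m(2) mult_nonneg_nonneg[of "H - m" "norm (u - x0)"] by (simp add: algebra_simps)
    ultimately show ?thesis by (meson ereal_less_eq(3) order_trans)
  next
    case False
    define r where "r = norm (u - x0)"
    have r: "r > 1" using False by (simp add: r_def)
    let ?w = "(1 - 1 / r) *\<^sub>R x0 + (1 / r) *\<^sub>R u"
    have "?w - x0 = (1 / r) *\<^sub>R (u - x0)" by (simp add: algebra_simps)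
    then have "norm (?w - x0) = \<bar>1 / r\<bar> * r" by (simp only: norm_scaleR r_def)
    then have "norm (?w - x0) = 1" using r by simp
    then have "ereal m \<le> h ?w"
      using p(2)[of ?w] m by (simp add: dist_norm norm_minus_commute)
    also have "\<dots> \<le> ereal (1 - 1 / r) * h x0 + ereal (1 / r) * h u"
      using conv r unfolding convex_ereal_def by auto
    finally have *: "ereal m \<le> ereal ((1 - 1 / r) * H) + ereal (1 / r) * h u"
      by (simp add: x0)
    show ?thesis
    proof (cases "h u")
      case (real c)
      then have "m \<le> (1 - 1 / r) * H + c / r" using * by simp
      then have "m * r \<le> (r - 1) * H + c" using r by (simp add: field_simps)
      then show ?thesis using real m(2) by (simp add: r_def[symmetric] algebra_simps)
    next
      case MInf
      then show ?thesis using assms(1) by (simp add: proper_def)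
    qed simp
  qed
  then show ?thesis using m(2) by (intro exI[of _ "H - m"]) auto
qed

text \<open>A strict bound at \<open>x\<close> leaves a margin \<open>e\<close>: nearby,
  \<open>q\<close> drops by less than \<open>e\<close> while \<open>h\<close> stays above
  \<open>c + e - q x\<close>.\<close>

lemma lower_semicontinuous_add_continuous:
  fixes h :: "'a::topological_space \<Rightarrow> ereal"
  assumes q: "continuous_on UNIV q" and lsc: "lower_semicontinuous h"
  shows "lower_semicontinuous (\<lambda>u. ereal (q u) + h u)"
  unfolding lower_semicontinuous_def le_Liminf_iff
proof (intro allI impI)
  fix x c assume c: "c < ereal (q x) + h x"
  have "\<exists>e>0. c + ereal (e - q x) < h x"
  proof (cases c)
    case (real r)
    show ?thesis
    proof (cases "h x")
      case (real H)
      then show ?thesis using c \<open>c = ereal r\<close>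
        by (intro exI[of _ "(q x + H - r) / 2"]) (auto simp: field_simps)
    next
      case PInf
      then show ?thesis using \<open>c = ereal r\<close> by (intro exI[of _ 1]) auto
    qed (use c in simp)
  next
    case MInf
    then show ?thesis using c by (intro exI[of _ 1]) (cases "h x"; auto)
  qed (use c in simp)
  then obtain e where e: "e > 0" "c + ereal (e - q x) < h x" by blast
  have "eventually (\<lambda>u. c + ereal (e - q x) < h u) (at x)"
    using lsc e(2) by (simp add: lower_semicontinuous_def le_Liminf_iff)
  moreover have "eventually (\<lambda>u. q x - e < q u) (at x)"
    using q e(1) by (intro order_tendstoD(1)[of q "q x"]) (auto simp: continuous_on_def)
  ultimately show "eventually (\<lambda>u. c < ereal (q u) + h u) (at x)"
  proof eventually_elim
    case (elim u)
    then show ?case by (cases c; cases "h u"; auto)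
  qed
qed

lemma eff_dom_properE:
  assumes "proper h" "u \<in> eff_dom h"
  shows "h u = ereal (real_of_ereal (h u))"
  using assms by (cases "h u") (auto simp: proper_def eff_dom_def)

text \<open>\<open>prox\<close> chooses arbitrarily unless a minimizer exists, so existence is the
  content: coercivity confines the search to a ball.\<close>

lemma prox_minimizes:
  fixes h :: "'a::euclidean_space \<Rightarrow> ereal"
  assumes pr: "proper h" and lsc: "lower_semicontinuous h" and conv: "convex_ereal h"
    and a: "\<alpha> > 0"
  shows "ereal ((norm (x - prox h x \<alpha>))\<^sup>2 / (2 * \<alpha>)) + h (prox h x \<alpha>)
    \<le> ereal ((norm (x - u))\<^sup>2 / (2 * \<alpha>)) + h u"
proof -
  let ?P = "\<lambda>u. ereal ((norm (x - u))\<^sup>2 / (2 * \<alpha>)) + h u"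
  obtain x0 where "x0 \<in> eff_dom h" using pr by (auto simp: proper_def)
  then obtain H where H: "h x0 = ereal H" using eff_dom_properE[OF pr] by blast
  obtain K where K: "K \<ge> 0" "\<And>u. ereal (H - K * (1 + norm (u - x0))) \<le> h u"
    using proper_lsc_convex_linear_lower_bound[OF pr lsc conv H] by blast
  define s where "s = norm (x - x0)"
  \<comment> \<open>For \<open>t \<ge> R\<close> both \<open>t \<ge> 1\<close> and \<open>t - 2 *
    \<alpha> * K \<ge> s\<^sup>2 + 2 * \<alpha> * K * (1 + s)\<close> hold; their product makes the
    quadratic outweigh the linear bound.\<close>
  define R where "R = 2 * \<alpha> * K + (s\<^sup>2 + 2 * \<alpha> * K * (1 + s)) + 1"
  have s: "s \<ge> 0" by (simp add: s_def)
  have "R \<ge> 0" using K a s by (simp add: R_def)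
  have out: "?P x0 \<le> ?P u" if u: "norm (x - u) \<ge> R" for u
  proof -
    define t where "t = norm (x - u)"
    have t: "t \<ge> R" "t \<ge> 0" using u by (simp_all add: t_def)
    have tri: "norm (u - x0) \<le> t + s"
      using norm_triangle_ineq[of "u - x" "x - x0"]
      by (simp add: t_def s_def norm_minus_commute)
    have R1: "R - 2 * \<alpha> * K \<ge> 1" "R \<ge> 1" using K a s by (auto simp: R_def)
    have "1 * (s\<^sup>2 + 2 * \<alpha> * K * (1 + s)) \<le> t * (t - 2 * \<alpha> * K)"
    proof (rule mult_mono)
      show "1 \<le> t" using R1 t by linarith
      show "s\<^sup>2 + 2 * \<alpha> * K * (1 + s) \<le> t - 2 * \<alpha> * K" using t by (simp add: R_def)
    qed (use t K a s in auto)
    then have "s\<^sup>2 \<le> t\<^sup>2 - 2 * \<alpha> * (K * (1 + (t + s)))"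
      by (simp add: algebra_simps power2_eq_square)
    then have "s\<^sup>2 / (2 * \<alpha>) \<le> (t\<^sup>2 - 2 * \<alpha> * (K * (1 + (t + s)))) / (2 * \<alpha>)"
      using a by (intro divide_right_mono) auto
    also have "\<dots> = t\<^sup>2 / (2 * \<alpha>) - K * (1 + (t + s))"
      using a by (simp add: diff_divide_distrib)
    also have "\<dots> \<le> t\<^sup>2 / (2 * \<alpha>) - K * (1 + norm (u - x0))"
      using tri K(1) by (intro diff_left_mono mult_left_mono) auto
    finally have "ereal (s\<^sup>2 / (2 * \<alpha>) + H)
        \<le> ereal (t\<^sup>2 / (2 * \<alpha>)) + ereal (H - K * (1 + norm (u - x0)))"
      by simp
    also have "\<dots> \<le> ereal (t\<^sup>2 / (2 * \<alpha>)) + h u"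
      by (intro add_left_mono K(2))
    finally show ?thesis by (simp add: H s_def t_def)
  qed
  have lscP: "lower_semicontinuous ?P"
    using a by (intro lower_semicontinuous_add_continuous lsc continuous_intros) auto
  \<comment> \<open>Enlarging the radius by \<open>s\<close> puts \<open>x0\<close> into the ball,
    so the minimum there also bounds the values outside.\<close>
  have x0c: "x0 \<in> cball x (R + s)" using \<open>R \<ge> 0\<close> by (simp add: s_def dist_norm)
  then obtain p where p: "\<And>v. v \<in> cball x (R + s) \<Longrightarrow> ?P p \<le> ?P v"
    using lower_semicontinuous_attains_inf[OF lscP compact_cball, of x "R + s"] by blast
  have "?P p \<le> ?P u" for u
  proof (cases "u \<in> cball x (R + s)")
    case False
    then have "norm (x - u) \<ge> R" using s by (simp add: dist_norm)
    then show ?thesis using out p[OF x0c] by (meson order_trans)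
  qed (rule p)
  then have "is_arg_min ?P (\<lambda>u. True) p" by (simp add: is_arg_min_linorder)
  then have "is_arg_min ?P (\<lambda>u. True) (prox h x \<alpha>)"
    unfolding prox_def arg_min_def by (rule someI)
  then show ?thesis by (simp add: is_arg_min_linorder)
qed

lemma prox_in_eff_dom:
  fixes h :: "'a::euclidean_space \<Rightarrow> ereal"
  assumes "proper h" "lower_semicontinuous h" "convex_ereal h" "\<alpha> > 0"
  shows "prox h x \<alpha> \<in> eff_dom h"
proof -
  obtain u where u: "u \<in> eff_dom h" using assms(1) by (auto simp: proper_def)
  have "ereal ((norm (x - prox h x \<alpha>))\<^sup>2 / (2 * \<alpha>)) + h (prox h x \<alpha>) < \<infinity>"
    by (rule le_less_trans[OF prox_minimizes[OF assms, of x u]]) (use u in \<open>simp add: eff_dom_def\<close>)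
  then show ?thesis by (auto simp: eff_dom_def)
qed

section \<open>Variational inequality for the proximal point\<close>

lemma convex_on_real_of_ereal:
  assumes "proper h" and conv: "convex_ereal h"
  shows "convex_on (eff_dom h) (\<lambda>u. real_of_ereal (h u))"
proof -
  \<comment> \<open>Staying in the domain is part of the claim, as \<open>real_of_ereal\<close>
    sends infinity to 0.\<close>
  have *: "u *\<^sub>R x + v *\<^sub>R y \<in> eff_dom h \<and>
      real_of_ereal (h (u *\<^sub>R x + v *\<^sub>R y)) \<le> u * real_of_ereal (h x) + v * real_of_ereal (h y)"
    if xy: "x \<in> eff_dom h" "y \<in> eff_dom h" and uv: "u \<ge> 0" "v \<ge> 0" "u + v = 1" for x y u v
  proof -
    have "h (u *\<^sub>R x + v *\<^sub>R y) \<le> ereal u * h x + ereal v * h y"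
      using conv uv by (simp add: convex_ereal_def)
    also have "\<dots> = ereal (u * real_of_ereal (h x) + v * real_of_ereal (h y))"
      using xy[THEN eff_dom_properE[OF assms(1)]] by (metis plus_ereal.simps(1) times_ereal.simps(1))
    finally show ?thesis
      using assms(1) by (cases "h (u *\<^sub>R x + v *\<^sub>R y)") (auto simp: eff_dom_def proper_def)
  qed
  then show ?thesis unfolding convex_on_def convex_def by blast
qed

text \<open>Minimality is tested along the segment from the proximal point to \<open>u\<close>;
  dividing by \<open>t\<close> and letting \<open>t\<close> tend to 0 removes the second-order
  term.\<close>

lemma prox_subgradient:
  fixes h :: "'a::euclidean_space \<Rightarrow> ereal"
  assumes h: "proper h" "lower_semicontinuous h" "convex_ereal h" and a: "\<alpha> > 0"
    and u: "u \<in> eff_dom h"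
  shows "real_of_ereal (h (prox h x \<alpha>)) + (x - prox h x \<alpha>) \<bullet> (u - prox h x \<alpha>) / \<alpha>
    \<le> real_of_ereal (h u)"
proof -
  define p where "p = prox h x \<alpha>"
  define \<phi> where "\<phi> = (\<lambda>u. real_of_ereal (h u))"
  have p: "p \<in> eff_dom h" unfolding p_def by (rule prox_in_eff_dom[OF h a])
  have conv: "convex_on (eff_dom h) \<phi>"
    unfolding \<phi>_def by (rule convex_on_real_of_ereal[OF h(1,3)])
  have min: "(norm (x - p))\<^sup>2 / (2 * \<alpha>) + \<phi> p \<le> (norm (x - v))\<^sup>2 / (2 * \<alpha>) + \<phi> v"
    if "v \<in> eff_dom h" for v
    using prox_minimizes[OF h a, of x v, folded p_def]
      eff_dom_properE[OF h(1) that] eff_dom_properE[OF h(1) p]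
    unfolding \<phi>_def by (metis ereal_less_eq(3) plus_ereal.simps(1))
  have small: "\<phi> p - \<phi> u + (x - p) \<bullet> (u - p) / \<alpha> \<le> t * ((norm (u - p))\<^sup>2 / (2 * \<alpha>))"
    if t: "0 < t" "t < 1" for t
  proof -
    let ?v = "(1 - t) *\<^sub>R p + t *\<^sub>R u"
    have v: "?v \<in> eff_dom h" "\<phi> ?v \<le> (1 - t) * \<phi> p + t * \<phi> u"
      using convex_onD[OF conv _ _ p u, of t] t p u conv
      by (auto simp: convex_on_def convex_def)
    have xv: "x - ?v = (x - p) - t *\<^sub>R (u - p)" by (simp add: algebra_simps)
    then have sq: "(norm (x - ?v))\<^sup>2
        = (norm (x - p))\<^sup>2 - 2 * t * ((x - p) \<bullet> (u - p)) + t\<^sup>2 * (norm (u - p))\<^sup>2"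
      unfolding xv power2_norm_eq_inner
      by (simp add: inner_diff_left inner_diff_right inner_commute power2_eq_square algebra_simps)
    have "t * (\<phi> p - \<phi> u) \<le> ((norm (x - ?v))\<^sup>2 - (norm (x - p))\<^sup>2) / (2 * \<alpha>)"
      using min[OF v(1)] v(2) by (simp add: algebra_simps diff_divide_distrib)
    also have "\<dots> = t * (t * ((norm (u - p))\<^sup>2 / (2 * \<alpha>)) - (x - p) \<bullet> (u - p) / \<alpha>)"
      unfolding sq using a by (simp add: field_simps power2_eq_square)
    finally show ?thesis using t by simp
  qed
  have "((\<lambda>t. t * ((norm (u - p))\<^sup>2 / (2 * \<alpha>))) \<longlongrightarrow> 0 * ((norm (u - p))\<^sup>2 / (2 * \<alpha>))) (at_right 0)"
    by (intro tendsto_intros)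
  moreover have "eventually (\<lambda>t. \<phi> p - \<phi> u + (x - p) \<bullet> (u - p) / \<alpha>
      \<le> t * ((norm (u - p))\<^sup>2 / (2 * \<alpha>))) (at_right 0)"
    using small by (auto simp: eventually_at_right_field intro: exI[of _ 1])
  ultimately have "\<phi> p - \<phi> u + (x - p) \<bullet> (u - p) / \<alpha> \<le> 0 * ((norm (u - p))\<^sup>2 / (2 * \<alpha>))"
    by (rule tendsto_lowerbound) simp
  then show ?thesis by (simp add: p_def \<phi>_def)
qed

section \<open>Smooth convex functions\<close>

text \<open>The adjoint of the derivative, applied to 1, is the representing vector; its uniqueness
  justifies \<open>THE\<close> in \<open>gradient\<close>.\<close>

lemma GDERIV_gradient:
  fixes f :: "'a::euclidean_space \<Rightarrow> real"
  assumes "f differentiable (at x)"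
  shows "GDERIV f x :> gradient f x"
proof -
  obtain f' where f': "(f has_derivative f') (at x)"
    using assms by (auto simp: differentiable_def)
  have "f' = (\<lambda>v. v \<bullet> adjoint f' 1)"
    using adjoint_works[OF has_derivative_linear[OF f'], of _ 1] by auto
  then have deriv: "GDERIV f x :> adjoint f' 1" using f' by (simp add: gderiv_def)
  have unique: "D = E" if "GDERIV f x :> D" "GDERIV f x :> E" for D E
  proof -
    have "(D - E) \<bullet> D = (D - E) \<bullet> E"
      using fun_cong[OF has_derivative_unique[OF that[unfolded gderiv_def]]] .
    then have "(D - E) \<bullet> (D - E) = 0" by (simp add: inner_diff_right)
    then show ?thesis by simp
  qed
  show ?thesis
    unfolding gradient_def by (rule theI[of "\<lambda>D. GDERIV f x :> D", OF deriv]) (rule unique[OF _ deriv])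
qed

lemma GDERIV_along_line:
  fixes f :: "'a::euclidean_space \<Rightarrow> real"
  assumes "f differentiable (at (x + t *\<^sub>R d))"
  shows "((\<lambda>t. f (x + t *\<^sub>R d)) has_real_derivative d \<bullet> gradient f (x + t *\<^sub>R d)) (at t)"
proof -
  have "((\<lambda>t. x + t *\<^sub>R d) has_derivative (\<lambda>s. s *\<^sub>R d)) (at t)"
    by (auto intro!: derivative_eq_intros)
  then have "((\<lambda>t. f (x + t *\<^sub>R d)) has_derivative
      (\<lambda>s. (s *\<^sub>R d) \<bullet> gradient f (x + t *\<^sub>R d))) (at t)"
    using has_derivative_compose GDERIV_gradient[OF assms, unfolded gderiv_def] by blast
  then show ?thesis
    by (simp add: has_field_derivative_def mult_commute_abs)
qed

text \<open>Along the segment, \<open>f\<close> minus its quadratic model has nonpositive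
  derivative; monotonicity takes the place of integrating the gradient.\<close>

lemma L_smooth_descent:
  fixes f :: "'a::euclidean_space \<Rightarrow> real"
  assumes "L_smooth L f"
  shows "f z \<le> f x + gradient f x \<bullet> (z - x) + L / 2 * (norm (z - x))\<^sup>2"
proof -
  have diff: "f differentiable (at u)"
    and lip: "norm (gradient f u - gradient f v) \<le> L * norm (u - v)" for u v
    using assms unfolding L_smooth_def by blast+
  define d where "d = z - x"
  define \<phi> where "\<phi> = (\<lambda>t. f (x + t *\<^sub>R d) - t * (d \<bullet> gradient f x) - L / 2 * t\<^sup>2 * (norm d)\<^sup>2)"
  have "\<phi> 0 \<ge> \<phi> 1"
  proof (rule DERIV_nonpos_imp_nonincreasing[of 0 1])
    fix t :: real assume t: "0 \<le> t" "t \<le> 1"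
    let ?D = "d \<bullet> gradient f (x + t *\<^sub>R d) - d \<bullet> gradient f x - L * t * (norm d)\<^sup>2"
    have "(\<phi> has_real_derivative ?D) (at t)"
      unfolding \<phi>_def by (auto intro!: derivative_eq_intros GDERIV_along_line[OF diff])
    moreover have "?D \<le> 0"
    proof -
      have "d \<bullet> (gradient f (x + t *\<^sub>R d) - gradient f x)
          \<le> norm d * norm (gradient f (x + t *\<^sub>R d) - gradient f x)"
        by (rule norm_cauchy_schwarz)
      also have "\<dots> \<le> norm d * (L * norm (x + t *\<^sub>R d - x))"
        by (intro mult_left_mono lip norm_ge_zero)
      also have "\<dots> = L * t * (norm d)\<^sup>2" using t by (simp add: power2_eq_square)
      finally show ?thesis by (simp add: inner_diff_right)
    qed
    ultimately show "\<exists>D. (\<phi> has_real_derivative D) (at t) \<and> D \<le> 0" by blast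
  qed simp
  then show ?thesis by (simp add: \<phi>_def d_def inner_commute)
qed

lemma convex_on_above_gradient:
  fixes f :: "'a::euclidean_space \<Rightarrow> real"
  assumes conv: "convex_on UNIV f" and "f differentiable (at x)"
  shows "f x + gradient f x \<bullet> (z - x) \<le> f z"
proof -
  let ?d = "z - x"
  let ?\<phi> = "\<lambda>t. f (x + t *\<^sub>R ?d)"
  have "convex_on UNIV ?\<phi>"
  proof (rule convex_onI)
    fix t a b :: real assume t: "0 < t" "t < 1"
    have "x + ((1 - t) *\<^sub>R a + t *\<^sub>R b) *\<^sub>R ?d = (1 - t) *\<^sub>R (x + a *\<^sub>R ?d) + t *\<^sub>R (x + b *\<^sub>R ?d)"
      by (simp add: algebra_simps)
    then show "?\<phi> ((1 - t) *\<^sub>R a + t *\<^sub>R b) \<le> (1 - t) * ?\<phi> a + t * ?\<phi> b"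
      using convex_onD[OF conv, of t] t by (metis UNIV_I less_imp_le)
  qed simp
  then have "?\<phi> 1 - ?\<phi> 0 \<ge> (?d \<bullet> gradient f (x + 0 *\<^sub>R ?d)) * (1 - 0)"
    using assms by (intro convex_on_imp_above_tangent[of UNIV] GDERIV_along_line) auto
  then show ?thesis by (simp add: inner_commute)
qed

text \<open>Evaluated at a basis vector, of norm 1, and at 0. This makes every \<open>L k\<close>
  positive.\<close>

lemma L_smooth_nonneg:
  fixes f :: "'a::euclidean_space \<Rightarrow> real"
  assumes "L_smooth L f"
  shows "L \<ge> 0"
proof -
  obtain b :: 'a where b: "b \<in> Basis" using nonempty_Basis by blast
  have "0 \<le> norm (gradient f b - gradient f 0)" by simp
  also have "\<dots> \<le> L * norm (b - 0)" using assms by (simp only: L_smooth_def)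
  finally show ?thesis using b by simp
qed

section \<open>The Moreau envelope\<close>

text \<open>The infimum of \<open>g u + (norm (x - u))\<^sup>2 / (2 * b)\<close> over
  \<open>u\<close>, written as the value at the proximal point, which attains it for convex
  \<open>g\<close> and \<open>b > 0\<close>.\<close>

definition moreau_envelope :: "('a::real_inner \<Rightarrow> real) \<Rightarrow> real \<Rightarrow> 'a \<Rightarrow> real" where
  "moreau_envelope g b x =
     (let p = prox (\<lambda>u. ereal (g u)) x b in g p + (norm (x - p))\<^sup>2 / (2 * b))"

lemma convex_on_UNIV_ereal:
  fixes g :: "'a::euclidean_space \<Rightarrow> real"
  assumes "convex_on UNIV g"
  shows "proper (\<lambda>u. ereal (g u))" "lower_semicontinuous (\<lambda>u. ereal (g u))"
    "convex_ereal (\<lambda>u. ereal (g u))" "eff_dom (\<lambda>u. ereal (g u)) = UNIV"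
proof -
  have cont: "continuous_on UNIV g" by (rule convex_on_continuous[OF open_UNIV assms])
  show "eff_dom (\<lambda>u. ereal (g u)) = UNIV" by (simp add: eff_dom_def)
  then show "proper (\<lambda>u. ereal (g u))" by (simp add: proper_def)
  show "convex_ereal (\<lambda>u. ereal (g u))"
    using assms by (simp add: convex_ereal_def convex_on_def)
  have "Liminf (at x) (\<lambda>u. ereal (g u)) = ereal (g x)" for x
    using cont by (intro lim_imp_Liminf) (auto simp: continuous_on_def)
  then show "lower_semicontinuous (\<lambda>u. ereal (g u))" by (simp add: lower_semicontinuous_def)
qed

lemma moreau_envelope_le:
  fixes g :: "'a::euclidean_space \<Rightarrow> real"
  assumes "convex_on UNIV g" "b > 0"
  shows "moreau_envelope g b x \<le> g u + (norm (x - u))\<^sup>2 / (2 * b)"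
  using prox_minimizes[OF convex_on_UNIV_ereal(1-3)[OF assms(1)] assms(2), of x u]
  by (simp add: moreau_envelope_def Let_def)

lemma moreau_envelope_le_self:
  fixes g :: "'a::euclidean_space \<Rightarrow> real"
  assumes "convex_on UNIV g" "b > 0"
  shows "moreau_envelope g b x \<le> g x"
  using moreau_envelope_le[OF assms, of x x] by simp

text \<open>
  The vector \<open>(x - p) / b\<close> below, with \<open>p\<close> the proximal point, is the gradient of the
  envelope at \<open>x\<close>, but differentiability is never needed: the two bounds express what is used
  of it.
\<close>

lemma moreau_envelope_upper:
  fixes g :: "'a::euclidean_space \<Rightarrow> real"
  assumes "convex_on UNIV g" "b > 0"
  defines "q \<equiv> \<lambda>x. (1 / b) *\<^sub>R (x - prox (\<lambda>u. ereal (g u)) x b)"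
  shows "moreau_envelope g b z
    \<le> moreau_envelope g b x + q x \<bullet> (z - x) + (norm (z - x))\<^sup>2 / (2 * b)"
proof -
  define p where "p = prox (\<lambda>u. ereal (g u)) x b"
  \<comment> \<open>The proximal point of \<open>x\<close> is the trial point for the envelope at
    \<open>z\<close>.\<close>
  have zx: "z - p = (x - p) + (z - x)" by simp
  have "(norm (z - p))\<^sup>2 = (norm (x - p))\<^sup>2 + 2 * ((x - p) \<bullet> (z - x)) + (norm (z - x))\<^sup>2"
    unfolding zx power2_norm_eq_inner
    by (simp only: inner_add_left inner_add_right inner_commute[of "z - x" "x - p"])
  moreover have "q x \<bullet> (z - x) = (x - p) \<bullet> (z - x) / b" by (simp add: q_def p_def)
  ultimately have "g p + (norm (z - p))\<^sup>2 / (2 * b)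
      = moreau_envelope g b x + q x \<bullet> (z - x) + (norm (z - x))\<^sup>2 / (2 * b)"
    using assms(2) by (simp add: moreau_envelope_def Let_def p_def[symmetric] field_simps)
  then show ?thesis using moreau_envelope_le[OF assms(1,2), of z p] by simp
qed

lemma moreau_envelope_lower:
  fixes g :: "'a::euclidean_space \<Rightarrow> real"
  assumes "convex_on UNIV g" "b > 0"
  defines "q \<equiv> \<lambda>x. (1 / b) *\<^sub>R (x - prox (\<lambda>u. ereal (g u)) x b)"
  shows "moreau_envelope g b x + q x \<bullet> (z - x) \<le> moreau_envelope g b z"
proof -
  define p where "p = prox (\<lambda>u. ereal (g u)) x b"
  define r where "r = prox (\<lambda>u. ereal (g u)) z b"
  have sub: "g p + (x - p) \<bullet> (r - p) / b \<le> g r"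
    using prox_subgradient[OF convex_on_UNIV_ereal(1-3)[OF assms(1)] assms(2), of r x]
    by (simp add: p_def convex_on_UNIV_ereal(4)[OF assms(1)])
  \<comment> \<open>After the subgradient inequality from \<open>p\<close> to \<open>r\<close>, the
    remaining slack is this square divided by \<open>2 * b\<close>.\<close>
  have "0 \<le> (norm ((x - p) - (z - r)))\<^sup>2" by simp
  also have "\<dots> = 2 * ((x - p) \<bullet> (r - p)) + (norm (z - r))\<^sup>2
      - (norm (x - p))\<^sup>2 - 2 * ((x - p) \<bullet> (z - x))"
    unfolding power2_norm_eq_inner
    by (simp add: inner_diff_left inner_diff_right inner_commute algebra_simps)
  finally have "((norm (x - p))\<^sup>2 + 2 * ((x - p) \<bullet> (z - x))) / (2 * b)
      \<le> (2 * ((x - p) \<bullet> (r - p)) + (norm (z - r))\<^sup>2) / (2 * b)"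
    using assms(2) by (intro divide_right_mono) auto
  then have "(norm (x - p))\<^sup>2 / (2 * b) + (x - p) \<bullet> (z - x) / b
      \<le> (x - p) \<bullet> (r - p) / b + (norm (z - r))\<^sup>2 / (2 * b)"
    by (simp add: add_divide_distrib)
  then show ?thesis
    using sub by (simp add: moreau_envelope_def Let_def q_def p_def[symmetric] r_def[symmetric])
qed

text \<open>
  The trial point at fraction \<open>b' / b\<close> of the way from \<open>x\<close> to the proximal point for \<open>b\<close>
  shows that the gap bound \<open>\<rho>\<^sup>2 b / 2\<close> absorbs the loss from decreasing the parameter.
\<close>

lemma moreau_envelope_antimono_corrected:
  fixes g :: "'a::euclidean_space \<Rightarrow> real"
  assumes g: "convex_on UNIV g" and lip: "\<And>u v. \<bar>g u - g v\<bar> \<le> \<rho> * norm (u - v)"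
    and b: "0 < b'" "b' \<le> b"
  shows "moreau_envelope g b' x + \<rho>\<^sup>2 * b' / 2 \<le> moreau_envelope g b x + \<rho>\<^sup>2 * b / 2"
proof -
  define p where "p = prox (\<lambda>u. ereal (g u)) x b"
  define d where "d = norm (x - p)"
  define t where "t = b' / b"
  have t: "0 < t" "t \<le> 1" "b' = t * b" and b0: "b > 0" using b by (auto simp: t_def)
  let ?u = "x + t *\<^sub>R (p - x)"
  have "?u - p = (1 - t) *\<^sub>R (x - p)" by (simp add: algebra_simps)
  then have up: "norm (?u - p) = (1 - t) * d" using t by (simp add: d_def)
  have xu: "norm (x - ?u) = t * d" using t by (simp add: d_def norm_minus_commute)
  have "moreau_envelope g b' x \<le> g ?u + (norm (x - ?u))\<^sup>2 / (2 * b')"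
    by (rule moreau_envelope_le[OF g b(1)])
  also have "(norm (x - ?u))\<^sup>2 / (2 * b') = t * (d\<^sup>2 / (2 * b))"
    unfolding xu t(3) using t(1) b0 by (simp add: power2_eq_square)
  also have "g ?u \<le> g p + \<rho> * ((1 - t) * d)"
    using lip[of ?u p] by (simp add: up)
  finally have le: "moreau_envelope g b' x \<le> g p + \<rho> * ((1 - t) * d) + t * (d\<^sup>2 / (2 * b))" by simp
  \<comment> \<open>Young's inequality for \<open>\<rho> * d\<close>; weighted by
    \<open>1 - t\<close>, it is exactly the slack required.\<close>
  have "0 \<le> (d - \<rho> * b)\<^sup>2 / (2 * b)" using b0 by simp
  also have "\<dots> = d\<^sup>2 / (2 * b) + \<rho>\<^sup>2 * b / 2 - \<rho> * d"
    using b0 by (simp add: power2_eq_square field_simps)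
  finally have "0 \<le> (1 - t) * (d\<^sup>2 / (2 * b) + \<rho>\<^sup>2 * b / 2 - \<rho> * d)"
    using t by simp
  then have "\<rho> * ((1 - t) * d) + t * (d\<^sup>2 / (2 * b)) + \<rho>\<^sup>2 * (t * b) / 2
      \<le> d\<^sup>2 / (2 * b) + \<rho>\<^sup>2 * b / 2"
    by (simp add: algebra_simps add_divide_distrib diff_divide_distrib)
  with le show ?thesis
    by (simp add: moreau_envelope_def Let_def p_def[symmetric] d_def[symmetric] t(3))
qed

text \<open>Young's inequality splits the Lipschitz bound \<open>\<rho> * d\<close> into the
  quadratic term of the envelope and \<open>\<rho>\<^sup>2 * b / 2\<close>.\<close>

lemma le_moreau_envelope:
  fixes g :: "'a::euclidean_space \<Rightarrow> real"
  assumes lip: "\<And>u v. \<bar>g u - g v\<bar> \<le> \<rho> * norm (u - v)" and b: "0 < b"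
  shows "g x \<le> moreau_envelope g b x + \<rho>\<^sup>2 * b / 2"
proof -
  define p where "p = prox (\<lambda>u. ereal (g u)) x b"
  define d where "d = norm (x - p)"
  have "0 \<le> (d - \<rho> * b)\<^sup>2 / (2 * b)" using b by simp
  also have "\<dots> = d\<^sup>2 / (2 * b) + \<rho>\<^sup>2 * b / 2 - \<rho> * d"
    using b by (simp add: power2_eq_square field_simps)
  finally show ?thesis
    using lip[of x p] by (simp add: moreau_envelope_def Let_def p_def[symmetric] d_def[symmetric])
qed

section \<open>One step of the algorithm\<close>

text \<open>The proximal inequality at \<open>z\<close> is added to the quadratic upper model of
  \<open>\<psi>\<close>; polarization turns the inner product into squared distances.\<close>

lemma forward_backward_step:
  fixes h :: "'a::euclidean_space \<Rightarrow> ereal" and \<psi> :: "'a \<Rightarrow> real"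
  assumes h: "proper h" "lower_semicontinuous h" "convex_ereal h" and L: "L > 0"
    and u: "u \<in> eff_dom h"
    and z: "z = prox h (y - (1 / L) *\<^sub>R G) (1 / L)"
    and upper: "\<psi> z \<le> \<psi> y + G \<bullet> (z - y) + L / 2 * (norm (z - y))\<^sup>2"
  shows "\<psi> z + real_of_ereal (h z) + L / 2 * (norm (u - z))\<^sup>2
    \<le> \<psi> y + G \<bullet> (u - y) + real_of_ereal (h u) + L / 2 * (norm (u - y))\<^sup>2"
proof -
  have "real_of_ereal (h z) + L * ((y - (1 / L) *\<^sub>R G - z) \<bullet> (u - z)) \<le> real_of_ereal (h u)"
    using prox_subgradient[OF h _ u, of "1 / L" "y - (1 / L) *\<^sub>R G"] L
    by (simp add: z[symmetric] mult.commute)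
  moreover have "L * ((y - (1 / L) *\<^sub>R G - z) \<bullet> (u - z)) = L * ((y - z) \<bullet> (u - z)) - G \<bullet> (u - z)"
    using L by (simp add: inner_diff_left algebra_simps)
  moreover have "L / 2 * (norm (u - y))\<^sup>2
      = L / 2 * (norm (u - z))\<^sup>2 + L / 2 * (norm (z - y))\<^sup>2 - L * ((y - z) \<bullet> (u - z))"
    unfolding power2_norm_eq_inner
    by (simp add: inner_diff_left inner_diff_right inner_commute algebra_simps)
  moreover have "G \<bullet> (u - y) = G \<bullet> (u - z) + G \<bullet> (z - y)"
    by (simp add: inner_diff_right)
  ultimately show ?thesis using upper by linarith
qed

text \<open>The previous inequality is used at
  \<open>(1 - \<theta>) *\<^sub>R x + \<theta> *\<^sub>R s\<close>. As \<open>y\<close> mixes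
  \<open>x\<close> and \<open>v\<close> with the same weights, \<open>x\<close> cancels and each
  squared distance gains a factor \<open>\<theta>\<^sup>2\<close>.\<close>

lemma accelerated_forward_backward_step:
  fixes h :: "'a::euclidean_space \<Rightarrow> ereal" and \<psi> :: "'a \<Rightarrow> real"
  assumes h: "proper h" "lower_semicontinuous h" "convex_ereal h" and L: "L > 0"
    and dom: "x \<in> eff_dom h" "s \<in> eff_dom h"
    and z: "z = prox h (y - (1 / L) *\<^sub>R G) (1 / L)"
    and upper: "\<And>u. \<psi> u \<le> \<psi> y + G \<bullet> (u - y) + L / 2 * (norm (u - y))\<^sup>2"
    and lower: "\<And>u. \<psi> y + G \<bullet> (u - y) \<le> \<psi> u"
    and \<theta>: "0 < \<theta>" "\<theta> \<le> 1" and y: "y = (1 - \<theta>) *\<^sub>R x + \<theta> *\<^sub>R v"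
  shows "\<psi> z + real_of_ereal (h z)
    \<le> (1 - \<theta>) * (\<psi> x + real_of_ereal (h x)) + \<theta> * (\<psi> s + real_of_ereal (h s))
      + \<theta>\<^sup>2 * L / 2 * ((norm (s - v))\<^sup>2 - (norm (s - (x + (1 / \<theta>) *\<^sub>R (z - x))))\<^sup>2)"
proof -
  let ?u = "(1 - \<theta>) *\<^sub>R x + \<theta> *\<^sub>R s"
  let ?H = "\<lambda>u. real_of_ereal (h u)"
  have conv: "convex_on (eff_dom h) ?H" by (rule convex_on_real_of_ereal[OF h(1,3)])
  have u: "?u \<in> eff_dom h" and Hu: "?H ?u \<le> (1 - \<theta>) * ?H x + \<theta> * ?H s"
    using conv dom \<theta> by (auto simp: convex_on_def convex_def)
  have "?u - y = \<theta> *\<^sub>R (s - v)" by (simp add: y algebra_simps)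
  then have uy: "(norm (?u - y))\<^sup>2 = \<theta>\<^sup>2 * (norm (s - v))\<^sup>2" by (simp add: power_mult_distrib)
  have "?u - z = \<theta> *\<^sub>R (s - (x + (1 / \<theta>) *\<^sub>R (z - x)))" using \<theta> by (simp add: algebra_simps)
  then have uz: "(norm (?u - z))\<^sup>2 = \<theta>\<^sup>2 * (norm (s - (x + (1 / \<theta>) *\<^sub>R (z - x))))\<^sup>2"
    by (simp only: norm_scaleR power_mult_distrib power2_abs)
  have "\<psi> y + G \<bullet> (?u - y)
      = (1 - \<theta>) * (\<psi> y + G \<bullet> (x - y)) + \<theta> * (\<psi> y + G \<bullet> (s - y))"
    by (simp add: inner_diff_right inner_add_right algebra_simps)
  also have "\<dots> \<le> (1 - \<theta>) * \<psi> x + \<theta> * \<psi> s"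
    using \<theta> by (intro add_mono mult_left_mono lower) auto
  finally have "\<psi> y + G \<bullet> (?u - y) \<le> (1 - \<theta>) * \<psi> x + \<theta> * \<psi> s" .
  with forward_backward_step[OF h L u z upper] Hu show ?thesis
    unfolding uy uz by (simp add: algebra_simps)
qed

text \<open>\<open>\<theta>\<close> is the positive root of
  \<open>c * \<theta>\<^sup>2 + \<theta> - 1 = 0\<close>. With
  \<open>c = L (k + 1) / ((\<theta> k)\<^sup>2 * L k)\<close> this matches the weights of
  consecutive steps.\<close>

lemma accelerated_parameter:
  fixes c :: real
  assumes "c > 0" and \<theta>: "\<theta> = 2 / (1 + sqrt (1 + 4 * c))"
  shows "0 < \<theta>" "\<theta> \<le> 1" "1 - \<theta> = \<theta>\<^sup>2 * c"
proof -
  define s where "s = sqrt (1 + 4 * c)"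
  have s: "s \<ge> 1" "s\<^sup>2 = 1 + 4 * c" using assms(1) by (auto simp: s_def)
  have \<theta>s: "\<theta> = 2 / (1 + s)" by (simp only: \<theta> s_def)
  show "0 < \<theta>" "\<theta> \<le> 1" using s(1) by (auto simp: \<theta>s)
  have "\<theta>\<^sup>2 * c = 4 * c / (1 + s)\<^sup>2"
    by (simp add: \<theta>s power_divide)
  also have "4 * c = (s - 1) * (1 + s)"
    using s(2) by (simp add: power2_eq_square algebra_simps)
  also have "(s - 1) * (1 + s) / (1 + s)\<^sup>2 = (s - 1) / (1 + s)"
    using s(1) by (simp add: power2_eq_square)
  also have "\<dots> = 1 - \<theta>" using s(1) by (simp add: \<theta>s divide_simps)
  finally show "1 - \<theta> = \<theta>\<^sup>2 * c" by simp
qed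

section \<open>Convergence rate with varying smoothing\<close>

theorem theorem3p1:
  fixes f g :: "real ^ 'n \<Rightarrow> real"
    and h F :: "real ^ 'n \<Rightarrow> ereal"
    and Lf \<rho>g :: real
    and \<beta> \<theta> L :: "nat \<Rightarrow> real"
    and x y :: "nat \<Rightarrow> real ^ 'n"
  assumes f_convex: "convex_on UNIV f"
    and f_smooth: "L_smooth Lf f"
    and g_convex: "convex_on UNIV g"
    and g_lipschitz: "\<And>u v. \<bar>g u - g v\<bar> \<le> \<rho>g * norm (u - v)"
    and h_proper: "proper h"
    and h_lsc: "lower_semicontinuous h"
    and h_convex: "convex_ereal h"
    and F_def: "\<And>u. F u = ereal (f u) + ereal (g u) + h u"
    and \<beta>_pos: "\<And>k. k \<ge> 1 \<Longrightarrow> \<beta> k > 0"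
    and prisma: "prisma f g h Lf \<beta> x y \<theta> L"
    and \<beta>_nonincreasing: "\<And>k. k \<ge> 1 \<Longrightarrow> \<beta> (k + 1) \<le> \<beta> k"
  shows "\<forall>k\<ge>1. \<forall>xstar \<in> eff_dom h.
    F (x (k + 1)) - F xstar \<le>
      ereal (1 / 2 * (\<theta> k)\<^sup>2 * L k *
        ((norm (xstar - x 1))\<^sup>2 + \<rho>g\<^sup>2 * (\<Sum>i = 1..k. \<beta> i / (\<theta> i * L i))))"
proof -
  let ?H = "\<lambda>u. real_of_ereal (h u)"
  note h = h_proper h_lsc h_convex
  \<comment> \<open>\<open>\<psi> k\<close> is the smooth part of the smoothed objective, and
    \<open>G k\<close> is its gradient at \<open>y k\<close>.\<close>
  define \<psi> where "\<psi> = (\<lambda>k u. f u + moreau_envelope g (\<beta> k) u)"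
  define q where "q = (\<lambda>k. (1 / \<beta> k) *\<^sub>R (y k - prox (\<lambda>u. ereal (g u)) (y k) (\<beta> k)))"
  define G where "G = (\<lambda>k. gradient f (y k) + q k)"
  \<comment> \<open>Solves \<open>y k = (1 - \<theta> k) *\<^sub>R x k + \<theta> k *\<^sub>R v
    k\<close> for \<open>v k\<close>.\<close>
  define v where "v = (\<lambda>k. (1 / \<theta> k) *\<^sub>R (y k - (1 - \<theta> k) *\<^sub>R x k))"
  have init: "x 1 = y 1" "x 1 \<in> eff_dom h" "\<theta> 1 = 1" "L 1 = Lf + 1 / \<beta> 1"
    and rec: "\<And>k. k \<ge> 1 \<Longrightarrow> L (k + 1) = Lf + 1 / \<beta> (k + 1)"
      "\<And>k. k \<ge> 1 \<Longrightarrow> \<theta> (k + 1) = 2 / (1 + sqrt (1 + 4 * L (k + 1) / ((\<theta> k)\<^sup>2 * L k)))"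
      "\<And>k. k \<ge> 1 \<Longrightarrow> x (k + 1) = prox h ((1 - 1 / (L k * \<beta> k)) *\<^sub>R y k
          - (1 / L k) *\<^sub>R gradient f (y k)
          + (1 / (L k * \<beta> k)) *\<^sub>R prox (\<lambda>u. ereal (g u)) (y k) (\<beta> k)) (1 / L k)"
      "\<And>k. k \<ge> 1 \<Longrightarrow>
          y (k + 1) = x (k + 1) + (\<theta> (k + 1) * (1 / \<theta> k - 1)) *\<^sub>R (x (k + 1) - x k)"
    using prisma unfolding prisma_def by blast+
  have L_eq: "L k = Lf + 1 / \<beta> k" if "k \<ge> 1" for k
    using that init(4) rec(1)[of "k - 1"] by (cases "k = 1") auto
  have L_pos: "L k > 0" if "k \<ge> 1" for k
    using L_eq[OF that] \<beta>_pos[OF that] L_smooth_nonneg[OF f_smooth] by (simp add: add_nonneg_pos)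
  have \<theta>_pos_le: "0 < \<theta> k \<and> \<theta> k \<le> 1" if "k \<ge> 1" for k
    using that
  proof (induction k rule: nat_induct_at_least)
    case (Suc k)
    then have "L (k + 1) / ((\<theta> k)\<^sup>2 * L k) > 0" using L_pos by simp
    from accelerated_parameter(1,2)[OF this] rec(2)[of k] Suc show ?case by simp
  qed (use init(3) in simp)
  have \<theta>_rec: "(1 - \<theta> (k + 1)) * ((\<theta> k)\<^sup>2 * L k) = (\<theta> (k + 1))\<^sup>2 * L (k + 1)" if "k \<ge> 1" for k
  proof -
    have pos: "(\<theta> k)\<^sup>2 * L k > 0" "L (k + 1) > 0" using \<theta>_pos_le[OF that] L_pos that by auto
    then have "L (k + 1) / ((\<theta> k)\<^sup>2 * L k) > 0" by simp
    from accelerated_parameter(3)[OF this] rec(2)[OF that]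
    have "1 - \<theta> (k + 1) = (\<theta> (k + 1))\<^sup>2 * (L (k + 1) / ((\<theta> k)\<^sup>2 * L k))" by simp
    then show ?thesis using less_imp_neq[OF pos(1)]
      by (simp only: times_divide_eq_right nonzero_eq_divide_eq not_sym)
  qed
  \<comment> \<open>The terms with factor \<open>1 / (L k * \<beta> k)\<close> combine to
    \<open>- (1 / L k) *\<^sub>R q k\<close>, which reveals a gradient step on
    \<open>\<psi> k\<close>.\<close>
  have x_rec: "x (k + 1) = prox h (y k - (1 / L k) *\<^sub>R G k) (1 / L k)" if "k \<ge> 1" for k
    unfolding rec(3)[OF that] G_def q_def by (simp add: algebra_simps)
  have x_dom: "x k \<in> eff_dom h" if "k \<ge> 1" for k
  proof (cases "k = 1")
    case False
    then have "k - 1 \<ge> 1" using that by simp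
    from x_rec[OF this] prox_in_eff_dom[OF h] L_pos[OF this] show ?thesis using that by simp
  qed (use init in simp)
  have y_eq: "y k = (1 - \<theta> k) *\<^sub>R x k + \<theta> k *\<^sub>R v k" if "k \<ge> 1" for k
    using \<theta>_pos_le[OF that] by (simp add: v_def)
  have v_1: "v 1 = x 1" unfolding v_def init(1,3) by simp
  \<comment> \<open>The momentum coefficient is the one that makes \<open>v (k + 1)\<close> the
    auxiliary point of the accelerated step inequality.\<close>
  have v_rec: "v (k + 1) = x k + (1 / \<theta> k) *\<^sub>R (x (k + 1) - x k)" if "k \<ge> 1" for k
  proof -
    have "y (k + 1) - (1 - \<theta> (k + 1)) *\<^sub>R x (k + 1)
        = \<theta> (k + 1) *\<^sub>R (x k + (1 / \<theta> k) *\<^sub>R (x (k + 1) - x k))"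
      unfolding rec(4)[OF that] by (simp add: algebra_simps)
    then show ?thesis using \<theta>_pos_le[of "k + 1"] by (simp add: v_def)
  qed
  have \<psi>_upper: "\<psi> k u \<le> \<psi> k (y k) + G k \<bullet> (u - y k) + L k / 2 * (norm (u - y k))\<^sup>2"
    if "k \<ge> 1" for k u
  proof -
    have "L k / 2 * (norm (u - y k))\<^sup>2
        = Lf / 2 * (norm (u - y k))\<^sup>2 + (norm (u - y k))\<^sup>2 / (2 * \<beta> k)"
      by (simp add: L_eq[OF that] algebra_simps add_divide_distrib)
    moreover have "G k \<bullet> (u - y k) = gradient f (y k) \<bullet> (u - y k) + q k \<bullet> (u - y k)"
      by (simp add: G_def inner_add_left)
    ultimately show ?thesis
      using L_smooth_descent[OF f_smooth, of u "y k"]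
        moreau_envelope_upper[OF g_convex \<beta>_pos[OF that], of u "y k"]
      unfolding \<psi>_def q_def by linarith
  qed
  have \<psi>_lower: "\<psi> k (y k) + G k \<bullet> (u - y k) \<le> \<psi> k u" if "k \<ge> 1" for k u
    using convex_on_above_gradient[OF f_convex, of "y k" u] f_smooth
      moreau_envelope_lower[OF g_convex \<beta>_pos[OF that], of "y k" u]
    by (simp add: \<psi>_def G_def q_def L_smooth_def inner_add_left)
  show ?thesis
  proof (intro allI impI ballI)
    fix k :: nat and s assume k: "1 \<le> k" and s: "s \<in> eff_dom h"
    define Fs where "Fs = f s + g s + ?H s"
    define A where "A = (\<lambda>k. \<psi> k (x (k + 1)) + ?H (x (k + 1)) + \<rho>g\<^sup>2 * \<beta> k / 2 - Fs)"
    \<comment> \<open>\<open>B (k + 1)\<close> and \<open>A k\<close> are taken at the same point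
      and differ only in the smoothing parameter.\<close>
    define B where "B = (\<lambda>k. \<psi> k (x k) + ?H (x k) + \<rho>g\<^sup>2 * \<beta> k / 2 - Fs)"
    define V where "V = (\<lambda>k. (norm (s - v k))\<^sup>2)"
    define S where "S = (\<lambda>k. \<rho>g\<^sup>2 * (\<Sum>i = 1..k. \<beta> i / (\<theta> i * L i)))"
    have step: "A k \<le> (1 - \<theta> k) * B k
        + (\<theta> k)\<^sup>2 * L k / 2 * (V k - V (k + 1) + \<rho>g\<^sup>2 * (\<beta> k / (\<theta> k * L k)))"
      if k: "k \<ge> 1" for k
    proof -
      have "\<psi> k (x (k + 1)) + ?H (x (k + 1))
          \<le> (1 - \<theta> k) * (\<psi> k (x k) + ?H (x k)) + \<theta> k * (\<psi> k s + ?H s)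
            + (\<theta> k)\<^sup>2 * L k / 2 * (V k - V (k + 1))"
        using accelerated_forward_backward_step[OF h L_pos[OF k] x_dom[OF k] s x_rec[OF k]
            \<psi>_upper[OF k] \<psi>_lower[OF k] _ _ y_eq[OF k]] \<theta>_pos_le[OF k]
        by (simp add: V_def v_rec[OF k, simplified])
      moreover have "\<theta> k * (\<psi> k s + ?H s) \<le> \<theta> k * Fs"
        using moreau_envelope_le_self[OF g_convex \<beta>_pos[OF k], of s] \<theta>_pos_le[OF k]
        by (intro mult_left_mono) (auto simp: Fs_def \<psi>_def)
      \<comment> \<open>Only the fraction \<open>\<theta> k\<close> of the correction is new, the
        rest being part of \<open>(1 - \<theta> k) * B k\<close>; hence a single power of
        \<open>\<theta> k\<close> in the denominator.\<close>
      moreover have "(\<theta> k)\<^sup>2 * L k / 2 * (\<rho>g\<^sup>2 * (\<beta> k / (\<theta> k * L k))) = \<theta> k * (\<rho>g\<^sup>2 * \<beta> k / 2)"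
        using L_pos[OF k] \<theta>_pos_le[OF k] by (simp add: power2_eq_square)
      moreover have "(1 - \<theta> k) * B k = (1 - \<theta> k) * (\<psi> k (x k) + ?H (x k))
          + \<rho>g\<^sup>2 * \<beta> k / 2 - \<theta> k * (\<rho>g\<^sup>2 * \<beta> k / 2) - Fs + \<theta> k * Fs"
        by (simp add: B_def algebra_simps diff_divide_distrib)
      ultimately show ?thesis
        unfolding A_def distrib_left[of _ "V k - V (k + 1)"] by linarith
    qed
    \<comment> \<open>Here the monotonicity of \<open>\<beta>\<close> enters.\<close>
    have B_le: "B (k + 1) \<le> A k" if k: "k \<ge> 1" for k
      using moreau_envelope_antimono_corrected[OF g_convex g_lipschitz \<beta>_pos \<beta>_nonincreasing[OF k],
          of "x (k + 1)"] by (simp add: A_def B_def \<psi>_def)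
    have A_le: "A k \<le> (\<theta> k)\<^sup>2 * L k / 2 * ((norm (s - x 1))\<^sup>2 - V (k + 1) + S k)"
      using k
    proof (induction k rule: nat_induct_at_least)
      case base
      \<comment> \<open>Since \<open>\<theta> 1 = 1\<close>, the term with \<open>B 1\<close>
        vanishes.\<close>
      show ?case using step[of 1] by (simp add: init(3)[simplified] S_def V_def v_1[simplified])
    next
      case (Suc k)
      have "(1 - \<theta> (k + 1)) * B (k + 1) \<le> (1 - \<theta> (k + 1)) * A k"
        using B_le[OF Suc(1)] \<theta>_pos_le[of "k + 1"] by (intro mult_left_mono) auto
      also have "\<dots> \<le> (1 - \<theta> (k + 1))
          * ((\<theta> k)\<^sup>2 * L k / 2 * ((norm (s - x 1))\<^sup>2 - V (k + 1) + S k))"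
        using Suc(2) \<theta>_pos_le[of "k + 1"] by (intro mult_left_mono) auto
      also have "\<dots> = (1 - \<theta> (k + 1)) * ((\<theta> k)\<^sup>2 * L k)
          / 2 * ((norm (s - x 1))\<^sup>2 - V (k + 1) + S k)"
        by simp
      also have "\<dots> = (\<theta> (k + 1))\<^sup>2 * L (k + 1) / 2 * ((norm (s - x 1))\<^sup>2 - V (k + 1) + S k)"
        by (simp only: \<theta>_rec[OF Suc(1)])
      finally have "A (k + 1) \<le> (\<theta> (k + 1))\<^sup>2 * L (k + 1) / 2
          * ((norm (s - x 1))\<^sup>2 - V (k + 1) + S k)
          + (\<theta> (k + 1))\<^sup>2 * L (k + 1) / 2
          * (V (k + 1) - V (k + 2) + \<rho>g\<^sup>2 * (\<beta> (k + 1) / (\<theta> (k + 1) * L (k + 1))))"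
        using step[of "k + 1"] by simp
      also have "\<dots> = (\<theta> (k + 1))\<^sup>2 * L (k + 1) / 2
          * ((norm (s - x 1))\<^sup>2 - V (k + 2) + S (k + 1))"
      proof -
        have "S (k + 1) = S k + \<rho>g\<^sup>2 * (\<beta> (k + 1) / (\<theta> (k + 1) * L (k + 1)))"
          by (simp add: S_def distrib_left)
        then show ?thesis by (simp only: distrib_left[symmetric]) (simp add: algebra_simps)
      qed
      finally show ?case by simp
    qed
    \<comment> \<open>Both values of \<open>F\<close> are finite, so the extended difference in the
      goal is a real one.\<close>
    have Fx: "F (x (k + 1)) = ereal (f (x (k + 1)) + g (x (k + 1)) + ?H (x (k + 1)))"
      using eff_dom_properE[OF h_proper x_dom[of "k + 1"]]
      by (simp add: F_def plus_ereal.simps(1)[symmetric] del: plus_ereal.simps)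
    have FFs: "F s = ereal Fs"
      using eff_dom_properE[OF h_proper s]
      by (simp add: F_def Fs_def plus_ereal.simps(1)[symmetric] del: plus_ereal.simps)
    have "f (x (k + 1)) + g (x (k + 1)) + ?H (x (k + 1)) - Fs \<le> A k"
      using le_moreau_envelope[OF g_lipschitz \<beta>_pos[OF k], of "x (k + 1)"]
      by (simp add: A_def \<psi>_def)
    also have "\<dots> \<le> (\<theta> k)\<^sup>2 * L k / 2 * ((norm (s - x 1))\<^sup>2 - V (k + 1) + S k)"
      by (rule A_le)
    also have "\<dots> \<le> (\<theta> k)\<^sup>2 * L k / 2 * ((norm (s - x 1))\<^sup>2 + S k)"
      using L_pos[OF k] by (intro mult_left_mono) (auto simp: V_def)
    finally show "F (x (k + 1)) - F s \<le>
        ereal (1 / 2 * (\<theta> k)\<^sup>2 * L k *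
          ((norm (s - x 1))\<^sup>2 + \<rho>g\<^sup>2 * (\<Sum>i = 1..k. \<beta> i / (\<theta> i * L i))))"
      unfolding Fx FFs by (simp add: S_def)
  qed
qed

end
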